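(* Let $f:\{\pm1\}^n\to\{\pm1\}$ be computable by a size-$s$ decision tree $T$ and let $\tau > 0$. There is a pruning $T^\star$ of $T$ satisfying: (i) $\Pr_{\boldsymbol{x}}[f(\boldsymbol{x}) \neq T^\star(\boldsymbol{x})] \le \tau \log s$, with $\boldsymbol{x}$ uniform over $\{\pm1\}^n$; (ii) for every internal node $v$ of $T^\star$, writing $i(v)$ for the variable queried at $v$, we have $\mathrm{Inf}_{i(v)}(f_v) \ge \tau$, where $f_v$ denotes the restriction of $f$ by the root-to-$v$ path in $T^\star$.
   Context: A decision tree over $\{\pm1\}^n$ is a binary tree whose internal nodes query a variable and branch on its value; its size is its number of leaves. A pruning of $T$ is any tree obtained from $T$ by iteratively replacing some internal node (together with its subtree) by one of that node's two child subtrees. For $g:\{\pm1\}^n\to\{\pm1\}$ and $i\in[n]$, $\mathrm{Inf}_i(g) = \Pr_{\boldsymbol{x}}[g(\boldsymbol{x}) \neq g(\boldsymbol{x}^{i})]$, where $\boldsymbol{x}$ is uniform over $\{\pm1\}^n$ and $\boldsymbol{x}^{i}$ is $\boldsymbol{x}$ with its $i$-th coordinate rerandomized (independently set uniformly at random). The restriction of $f$ by a root-to-$v$ path is the function obtained by fixing the variables queried along the path to the values on that path. $\log$ is base 2. *)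

theory Defs
  imports "HOL-Probability.Probability"
begin

definition cube :: "nat \<Rightarrow> (nat \<Rightarrow> int) set" where
  "cube n = {1..n} \<rightarrow>\<^sub>E {-1, 1}"

(* In Query i l r the left subtree l is the branch x i = -1, the right subtree r is x i = 1.
   A variable may be queried repeatedly along a path. *)
datatype dtree = Leaf int | Query nat dtree dtree

primrec dtree_over :: "nat \<Rightarrow> dtree \<Rightarrow> bool" where
  "dtree_over n (Leaf b) \<longleftrightarrow> b \<in> {-1, 1}"
| "dtree_over n (Query i l r) \<longleftrightarrow> i \<in> {1..n} \<and> dtree_over n l \<and> dtree_over n r"

primrec dtree_eval :: "dtree \<Rightarrow> (nat \<Rightarrow> int) \<Rightarrow> int" where
  "dtree_eval (Leaf b) x = b"
| "dtree_eval (Query i l r) x = (if x i = -1 then dtree_eval l x else dtree_eval r x)"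

primrec num_leaves :: "dtree \<Rightarrow> nat" where
  "num_leaves (Leaf b) = 1"
| "num_leaves (Query i l r) = num_leaves l + num_leaves r"

definition computes :: "nat \<Rightarrow> dtree \<Rightarrow> ((nat \<Rightarrow> int) \<Rightarrow> int) \<Rightarrow> bool" where
  "computes n T f \<longleftrightarrow> (\<forall>x\<in>cube n. dtree_eval T x = f x)"

inductive prune_step :: "dtree \<Rightarrow> dtree \<Rightarrow> bool" where
  to_left: "prune_step (Query i l r) l"
| to_right: "prune_step (Query i l r) r"
| in_left: "prune_step l l' \<Longrightarrow> prune_step (Query i l r) (Query i l' r)"
| in_right: "prune_step r r' \<Longrightarrow> prune_step (Query i l r) (Query i l r')"

definition is_pruning :: "dtree \<Rightarrow> dtree \<Rightarrow> bool" where
  "is_pruning T' T \<longleftrightarrow> prune_step\<^sup>*\<^sup>* T T'"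

(* One pair (p, i) per internal node v: p is the root-to-v path, listing from the root the
   queried variables with the values taken, and i is the variable queried at v. *)
primrec internal_nodes :: "dtree \<Rightarrow> ((nat \<times> int) list \<times> nat) set" where
  "internal_nodes (Leaf b) = {}"
| "internal_nodes (Query i l r) = insert ([], i)
     ({((i, -1) # p, j) | p j. (p, j) \<in> internal_nodes l} \<union>
      {((i, 1) # p, j) | p j. (p, j) \<in> internal_nodes r})"

(* The restricted function keeps all n arguments and ignores those fixed by the path, so a fixed
   variable has influence 0 on it.  If a path repeats a variable, the value nearest the root counts. *)
definition restriction ::
    "((nat \<Rightarrow> int) \<Rightarrow> int) \<Rightarrow> (nat \<times> int) list \<Rightarrow> (nat \<Rightarrow> int) \<Rightarrow> int" where
  "restriction f p = (\<lambda>x. f (\<lambda>j. case map_of p j of None \<Rightarrow> x j | Some b \<Rightarrow> b))"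

(* The second component b is the fresh value of the rerandomized coordinate, so this is half the
   probability that flipping coordinate i changes g. *)
definition influence :: "nat \<Rightarrow> nat \<Rightarrow> ((nat \<Rightarrow> int) \<Rightarrow> int) \<Rightarrow> real" where
  "influence n i g =
     measure_pmf.prob (pair_pmf (pmf_of_set (cube n)) (pmf_of_set {-1, 1}))
       {(x, b). g x \<noteq> g (x(i := b))}"

end

theory Submission
  imports Defs
begin

text \<open>Replacing the root query \<open>i\<close> of a tree by a uniformly random one of its two subtrees
  raises the expected distance to \<open>f\<close> by at most \<open>Inf\<^sub>i(f)\<close>, provided that the subtrees do not
  query \<open>i\<close> again. Going down from the root, one keeps every query of influence at least \<open>\<tau>\<close> and
  replaces any other by the subtree \<open>t\<close> that minimises the distance to \<open>f\<close> plus
  \<open>\<tau> log |t|\<close>. As the mean of \<open>log a\<close> and \<open>log b\<close> is at most \<open>log (a + b) - 1\<close>, the minimum is at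
  most the distance of the whole tree plus \<open>\<tau> log (a + b)\<close>, so this quantity never increases.
  Queries repeated along a path can be pruned beforehand without changing the computed function.\<close>

section \<open>Prunings\<close>

primrec queried :: "dtree \<Rightarrow> nat set" where
  "queried (Leaf b) = {}"
| "queried (Query i l r) = insert i (queried l \<union> queried r)"

text \<open>This makes both subtrees of a query independent of the coordinate queried, so that
  restricting the function at that coordinate leaves them unchanged.\<close>

primrec no_repeats :: "dtree \<Rightarrow> bool" where
  "no_repeats (Leaf b) \<longleftrightarrow> True"
| "no_repeats (Query i l r) \<longleftrightarrow>
     i \<notin> queried l \<and> i \<notin> queried r \<and> no_repeats l \<and> no_repeats r"

lemma is_pruning_refl: "is_pruning T T"
  by (simp add: is_pruning_def)

lemma is_pruning_trans: "is_pruning T'' T' \<Longrightarrow> is_pruning T' T \<Longrightarrow> is_pruning T'' T"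
  by (simp add: is_pruning_def)

lemma is_pruning_left: "is_pruning l' l \<Longrightarrow> is_pruning l' (Query i l r)"
  unfolding is_pruning_def by (metis converse_rtranclp_into_rtranclp to_left)

lemma is_pruning_right: "is_pruning r' r \<Longrightarrow> is_pruning r' (Query i l r)"
  unfolding is_pruning_def by (metis converse_rtranclp_into_rtranclp to_right)

lemma is_pruning_Query:
  assumes "is_pruning l' l" "is_pruning r' r"
  shows "is_pruning (Query i l' r') (Query i l r)"
proof -
  have "prune_step\<^sup>*\<^sup>* (Query i l r) (Query i l' r)"
    using assms(1) unfolding is_pruning_def
    by induction (auto intro: rtranclp.rtrancl_into_rtrancl in_left)
  moreover have "prune_step\<^sup>*\<^sup>* (Query i l' r) (Query i l' r')"
    using assms(2) unfolding is_pruning_def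
    by induction (auto intro: rtranclp.rtrancl_into_rtrancl in_right)
  ultimately show ?thesis
    unfolding is_pruning_def by (rule rtranclp_trans)
qed

lemma queried_pruning:
  assumes "is_pruning T' T"
  shows "queried T' \<subseteq> queried T"
proof -
  have "prune_step T T' \<Longrightarrow> queried T' \<subseteq> queried T" for T T'
    by (induction rule: prune_step.induct) auto
  with assms show ?thesis
    unfolding is_pruning_def by (induction rule: rtranclp_induct) blast+
qed

lemma dtree_over_pruning:
  assumes "is_pruning T' T" "dtree_over n T"
  shows "dtree_over n T'"
proof -
  have "prune_step T T' \<Longrightarrow> dtree_over n T \<Longrightarrow> dtree_over n T'" for T T'
    by (induction rule: prune_step.induct) auto
  with assms show ?thesis
    unfolding is_pruning_def by (induction rule: rtranclp_induct) blast+
qed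

lemma num_leaves_pruning:
  assumes "is_pruning T' T"
  shows "num_leaves T' \<le> num_leaves T"
proof -
  have "prune_step T T' \<Longrightarrow> num_leaves T' \<le> num_leaves T" for T T'
    by (induction rule: prune_step.induct) auto
  with assms show ?thesis
    unfolding is_pruning_def by (induction rule: rtranclp_induct) (auto intro: order_trans)
qed

lemma num_leaves_pos: "num_leaves T > 0"
  by (induction T) auto

lemma dtree_eval_fun_upd:
  "i \<notin> queried T \<Longrightarrow> dtree_eval T (x(i := b)) = dtree_eval T x"
  by (induction T) auto

text \<open>The map \<open>m\<close> holds the outcomes of the queries made above \<open>T\<close>; \<open>True\<close> stands for the left
  branch.\<close>

lemma ex_no_repeats_pruning_aux:
  "\<exists>T'. is_pruning T' T \<and> no_repeats T' \<and> queried T' \<inter> dom m = {} \<and>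
     (\<forall>x. (\<forall>i c. m i = Some c \<longrightarrow> (x i = -1) = c) \<longrightarrow> dtree_eval T' x = dtree_eval T x)"
proof (induction T arbitrary: m)
  case (Leaf b)
  show ?case
    by (rule exI[of _ "Leaf b"]) (simp add: is_pruning_refl)
next
  case (Query i l r)
  show ?case
  proof (cases "m i")
    case None
    \<comment> \<open>Recording the outcome at \<open>i\<close> makes the disjointness from the
      enlarged domain give both \<open>i\<close> fresh in the pruned subtree and disjointness from
      \<open>dom m\<close>.\<close>
    obtain l' where l': "is_pruning l' l" "no_repeats l'" "queried l' \<inter> dom (m(i \<mapsto> True)) = {}"
      "\<And>x. (\<forall>j c. (m(i \<mapsto> True)) j = Some c \<longrightarrow> (x j = -1) = c) \<Longrightarrow> dtree_eval l' x = dtree_eval l x"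
      using Query.IH(1)[of "m(i \<mapsto> True)"] by blast
    obtain r' where r': "is_pruning r' r" "no_repeats r'" "queried r' \<inter> dom (m(i \<mapsto> False)) = {}"
      "\<And>x. (\<forall>j c. (m(i \<mapsto> False)) j = Some c \<longrightarrow> (x j = -1) = c) \<Longrightarrow> dtree_eval r' x = dtree_eval r x"
      using Query.IH(2)[of "m(i \<mapsto> False)"] by blast
    have "dtree_eval (Query i l' r') x = dtree_eval (Query i l r) x"
      if "\<forall>j c. m j = Some c \<longrightarrow> (x j = -1) = c" for x
      using that l'(4)[of x] r'(4)[of x] by auto
    then show ?thesis
      using l'(1-3) r'(1-3) None
      by (intro exI[of _ "Query i l' r'"]) (auto simp: is_pruning_Query)
  next
    case (Some c)
    define t where "t = (if c then l else r)"
    have eval: "dtree_eval (Query i l r) x = dtree_eval t x"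
      if "\<forall>j c. m j = Some c \<longrightarrow> (x j = -1) = c" for x
      using that Some by (simp add: t_def)
    obtain t' where t': "is_pruning t' t" "no_repeats t'" "queried t' \<inter> dom m = {}"
      "\<And>x. (\<forall>j c. m j = Some c \<longrightarrow> (x j = -1) = c) \<Longrightarrow> dtree_eval t' x = dtree_eval t x"
      using Query.IH(1)[of m] Query.IH(2)[of m] unfolding t_def by (cases c) auto
    have "is_pruning t' (Query i l r)"
      using t'(1) by (cases c) (simp_all add: t_def is_pruning_left is_pruning_right)
    then show ?thesis
      using t'(2-4) eval by (intro exI[of _ t']) simp
  qed
qed

text \<open>The empty map constrains no input, so the two trees agree everywhere, not just on inputs
  consistent with some path.\<close>

lemma ex_no_repeats_pruning:
  obtains T' where "is_pruning T' T" "no_repeats T'" "dtree_eval T' = dtree_eval T"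
  using ex_no_repeats_pruning_aux[of T Map.empty] by fastforce

section \<open>Splitting the uniform distribution along a coordinate\<close>

abbreviation cube_prob :: "nat \<Rightarrow> ((nat \<Rightarrow> int) \<Rightarrow> bool) \<Rightarrow> real" where
  "cube_prob n P \<equiv> measure_pmf.prob (pmf_of_set (cube n)) {x. P x}"

lemma finite_cube: "finite (cube n)"
  unfolding cube_def by (intro finite_PiE) auto

lemma cube_nonempty: "cube n \<noteq> {}"
  unfolding cube_def by (simp add: PiE_eq_empty_iff)

lemma cube_prob_eq: "cube_prob n P = (\<Sum>x\<in>cube n. of_bool (P x)) / card (cube n)"
  by (simp add: measure_pmf_of_set finite_cube cube_nonempty Int_def)

lemma cube_prob_cong: "(\<And>x. x \<in> cube n \<Longrightarrow> P x = Q x) \<Longrightarrow> cube_prob n P = cube_prob n Q"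
  by (simp add: cube_prob_eq cong: sum.cong)

lemma bij_betw_flip:
  assumes "i \<in> {1..n}"
  shows "bij_betw (\<lambda>x. x(i := - x i)) (cube n) (cube n)"
  using assms by (intro bij_betw_byWitness[where f' = "\<lambda>x. x(i := - x i)"])
    (force simp: cube_def PiE_iff extensional_def)+

text \<open>A point and its flip at \<open>i\<close> are \<open>x(i := -1)\<close> and
  \<open>x(i := 1)\<close> in some order, and flipping permutes the cube. Hence summing over all
  such pairs counts every point twice.\<close>

lemma cube_prob_split:
  assumes "i \<in> {1..n}"
  shows "cube_prob n P = (cube_prob n (\<lambda>x. P (x(i := -1))) + cube_prob n (\<lambda>x. P (x(i := 1)))) / 2"
proof -
  let ?S = "\<lambda>Q. \<Sum>x\<in>cube n. of_bool (Q x) :: real"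
  have "?S P + ?S (\<lambda>x. P (x(i := - x i))) = ?S (\<lambda>x. P (x(i := -1))) + ?S (\<lambda>x. P (x(i := 1)))"
    unfolding sum.distrib[symmetric]
  proof (rule sum.cong[OF refl])
    fix x assume "x \<in> cube n"
    then have "x i = -1 \<or> x i = 1"
      using assms by (auto simp: cube_def)
    then show "of_bool (P x) + of_bool (P (x(i := - x i))) =
        (of_bool (P (x(i := -1))) + of_bool (P (x(i := 1))) :: real)"
      by (metis add.commute fun_upd_triv minus_minus)
  qed
  moreover have "?S (\<lambda>x. P (x(i := - x i))) = ?S P"
    by (rule sum.reindex_bij_betw[OF bij_betw_flip[OF assms]])
  ultimately have "?S (\<lambda>x. P (x(i := -1))) + ?S (\<lambda>x. P (x(i := 1))) = 2 * ?S P"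
    by linarith
  then show ?thesis
    by (simp add: cube_prob_eq flip: add_divide_distrib)
qed

lemma pair_pmf_of_set:
  assumes "finite A" "A \<noteq> {}" "finite B" "B \<noteq> {}"
  shows "pair_pmf (pmf_of_set A) (pmf_of_set B) = pmf_of_set (A \<times> B)"
proof (rule pmf_eqI)
  fix z :: "'a \<times> 'b"
  show "pmf (pair_pmf (pmf_of_set A) (pmf_of_set B)) z = pmf (pmf_of_set (A \<times> B)) z"
    using assms by (cases z) (simp add: pmf_pair card_cartesian_product indicator_def)
qed

lemma influence_eq:
  "influence n i g =
     (cube_prob n (\<lambda>x. g x \<noteq> g (x(i := -1))) + cube_prob n (\<lambda>x. g x \<noteq> g (x(i := 1)))) / 2"
proof -
  have "influence n i g = real (card (cube n \<times> {-1, 1} \<inter> {(x, b). g x \<noteq> g (x(i := b))})) /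
      real (card (cube n \<times> {-1, 1 :: int}))"
    by (simp add: influence_def pair_pmf_of_set finite_cube cube_nonempty measure_pmf_of_set)
  also have "real (card (cube n \<times> {-1, 1} \<inter> {(x, b). g x \<noteq> g (x(i := b))})) =
      (\<Sum>z\<in>cube n \<times> {-1, 1}. of_bool (z \<in> {(x, b). g x \<noteq> g (x(i := b))}))"
    by (simp add: finite_cube)
  also have "\<dots> = (\<Sum>x\<in>cube n. \<Sum>b\<in>{-1, 1}. of_bool (g x \<noteq> g (x(i := b))))"
    unfolding sum.cartesian_product by (simp only: case_prod_unfold mem_Collect_eq)
  finally show ?thesis
    by (simp add: cube_prob_eq card_cartesian_product sum.distrib add_divide_distrib mult.commute
        del: sum_of_bool_eq)
qed

section \<open>Distance of a tree to a function\<close>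

abbreviation tree_dist :: "nat \<Rightarrow> ((nat \<Rightarrow> int) \<Rightarrow> int) \<Rightarrow> dtree \<Rightarrow> real" where
  "tree_dist n f T \<equiv> cube_prob n (\<lambda>x. f x \<noteq> dtree_eval T x)"

lemma restriction_single: "restriction f [(i, b)] x = f (x(i := b))"
  unfolding restriction_def by (rule arg_cong[of _ _ f]) auto

text \<open>\<open>map_of\<close> lets the first pair win, and on the right coordinate
  \<open>i\<close> is overwritten last, so both sides agree even if \<open>p\<close> mentions
  \<open>i\<close> again.\<close>

lemma restriction_Cons: "restriction f ((i, b) # p) = restriction (restriction f [(i, b)]) p"
  unfolding restriction_def by (intro ext arg_cong[of _ _ f]) auto

lemma tree_dist_Query:
  assumes "i \<in> {1..n}" "i \<notin> queried l" "i \<notin> queried r"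
  shows "tree_dist n f (Query i l r) =
    (tree_dist n (restriction f [(i, -1)]) l + tree_dist n (restriction f [(i, 1)]) r) / 2"
  by (subst cube_prob_split[OF assms(1)])
    (simp add: restriction_single dtree_eval_fun_upd assms(2,3))

text \<open>A union bound: where \<open>f x\<close> and the tree differ,
  \<open>f (x(i := b))\<close> must differ from one of them.\<close>

lemma tree_dist_le_restriction:
  "tree_dist n f T \<le>
    cube_prob n (\<lambda>x. f x \<noteq> f (x(i := b))) + tree_dist n (restriction f [(i, b)]) T"
proof -
  have "tree_dist n f T \<le> measure_pmf.prob (pmf_of_set (cube n))
      ({x. f x \<noteq> f (x(i := b))} \<union> {x. f (x(i := b)) \<noteq> dtree_eval T x})"
    by (intro measure_pmf.finite_measure_mono) auto
  also have "\<dots> \<le> cube_prob n (\<lambda>x. f x \<noteq> f (x(i := b))) +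
      cube_prob n (\<lambda>x. f (x(i := b)) \<noteq> dtree_eval T x)"
    by (rule measure_Un_le) auto
  finally show ?thesis
    by (simp add: restriction_single)
qed

lemma mean_tree_dist_subtrees:
  assumes "i \<in> {1..n}" "i \<notin> queried l" "i \<notin> queried r"
  shows "(tree_dist n f l + tree_dist n f r) / 2 \<le>
    tree_dist n f (Query i l r) + influence n i f"
  \<comment> \<open>Each subtree is compared with the restriction to its own branch. The two
    probabilities that forcing \<open>i\<close> changes \<open>f\<close> then average to the
    influence.\<close>
  using tree_dist_le_restriction[of n f l i "-1"] tree_dist_le_restriction[of n f r i 1]
  unfolding tree_dist_Query[OF assms] influence_eq by argo

text \<open>The inequality of arithmetic and geometric means, after taking logarithms; the factor 4
  becomes the gain of 1.\<close>

lemma mean_log2_le: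
  fixes a b :: real
  assumes "a > 0" "b > 0"
  shows "(log 2 a + log 2 b) / 2 \<le> log 2 (a + b) - 1"
proof -
  have "4 * (a * b) \<le> (a + b)\<^sup>2"
    using sum_squares_ge_zero[of "a - b" 0] by (simp add: power2_eq_square algebra_simps)
  then have "log 2 (4 * (a * b)) \<le> log 2 ((a + b)\<^sup>2)"
    using assms by (subst log_le_cancel_iff) auto
  moreover have "log 2 (4 * (a * b)) = 2 + (log 2 a + log 2 b)"
    using assms log_nat_power[of 2 2 2] by (simp add: log_mult)
  ultimately show ?thesis
    using assms by (simp add: log_nat_power)
qed

text \<open>The error is relative to the distance of \<open>T\<close> and \<open>f\<close> is
  arbitrary in the induction: a kept query hands the restrictions of \<open>f\<close> to its
  subtrees, a replaced one hands on \<open>f\<close> itself, which the subtree may compute only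
  approximately.\<close>

lemma ex_influential_pruning:
  assumes "\<tau> > 0" "dtree_over n T" "no_repeats T"
  shows "\<exists>T'. is_pruning T' T \<and>
    tree_dist n f T' \<le> tree_dist n f T + \<tau> * log 2 (num_leaves T) \<and>
    (\<forall>(p, i)\<in>internal_nodes T'. influence n i (restriction f p) \<ge> \<tau>)"
  using assms(2,3)
proof (induction T arbitrary: f)
  case (Leaf b)
  show ?case
    by (rule exI[of _ "Leaf b"]) (simp add: is_pruning_refl)
next
  case (Query i l r)
  have i: "i \<in> {1..n}" "i \<notin> queried l" "i \<notin> queried r"
    using Query.prems by auto
  have IHl: "\<exists>l'. is_pruning l' l \<and>
      tree_dist n g l' \<le> tree_dist n g l + \<tau> * log 2 (num_leaves l) \<and>
      (\<forall>(p, i)\<in>internal_nodes l'. influence n i (restriction g p) \<ge> \<tau>)" for g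
    using Query by simp
  have IHr: "\<exists>r'. is_pruning r' r \<and>
      tree_dist n g r' \<le> tree_dist n g r + \<tau> * log 2 (num_leaves r) \<and>
      (\<forall>(p, i)\<in>internal_nodes r'. influence n i (restriction g p) \<ge> \<tau>)" for g
    using Query by simp
  have "\<tau> * ((log 2 (num_leaves l) + log 2 (num_leaves r)) / 2) \<le>
      \<tau> * (log 2 (num_leaves (Query i l r)) - 1)"
    using mean_log2_le[of "num_leaves l" "num_leaves r"] \<open>\<tau> > 0\<close>
    by (intro mult_left_mono) (simp_all add: num_leaves_pos)
  then have log_le: "(\<tau> * log 2 (num_leaves l) + \<tau> * log 2 (num_leaves r)) / 2 \<le>
      \<tau> * log 2 (num_leaves (Query i l r)) - \<tau>"
    by (simp add: algebra_simps)
  show ?case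
  proof (cases "influence n i f \<ge> \<tau>")
    case True
    obtain l' where l': "is_pruning l' l"
      "tree_dist n (restriction f [(i, -1)]) l' \<le>
        tree_dist n (restriction f [(i, -1)]) l + \<tau> * log 2 (num_leaves l)"
      "\<forall>(p, j)\<in>internal_nodes l'. influence n j (restriction (restriction f [(i, -1)]) p) \<ge> \<tau>"
      using IHl[of "restriction f [(i, -1)]"] by blast
    obtain r' where r': "is_pruning r' r"
      "tree_dist n (restriction f [(i, 1)]) r' \<le>
        tree_dist n (restriction f [(i, 1)]) r + \<tau> * log 2 (num_leaves r)"
      "\<forall>(p, j)\<in>internal_nodes r'. influence n j (restriction (restriction f [(i, 1)]) p) \<ge> \<tau>"
      using IHr[of "restriction f [(i, 1)]"] by blast
    \<comment> \<open>Pruning introduces no queries, so the distance still splits at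
      \<open>i\<close> after both subtrees are pruned.\<close>
    have i': "i \<notin> queried l'" "i \<notin> queried r'"
      using i queried_pruning l'(1) r'(1) by blast+
    have "tree_dist n f (Query i l' r') \<le>
        tree_dist n f (Query i l r) + \<tau> * log 2 (num_leaves (Query i l r))"
      unfolding tree_dist_Query[OF i] tree_dist_Query[OF i(1) i']
      using l'(2) r'(2) log_le \<open>\<tau> > 0\<close> by argo
    moreover have "\<forall>(p, j)\<in>internal_nodes (Query i l' r'). influence n j (restriction f p) \<ge> \<tau>"
    proof -
      have "restriction f [] = f"
        by (simp add: restriction_def)
      then show ?thesis
        using True l'(3) r'(3) by (auto simp flip: restriction_Cons)
    qed
    ultimately show ?thesis
      using is_pruning_Query[OF l'(1) r'(1)] by blast
  next
    case False
    \<comment> \<open>The influence lost is below \<open>\<tau>\<close>, which the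
      \<open>- \<tau>\<close> in \<open>log_le\<close> absorbs. Since the mean stays within the
      bound, so does one of the two subtrees.\<close>
    then have "(tree_dist n f l + \<tau> * log 2 (num_leaves l) +
        (tree_dist n f r + \<tau> * log 2 (num_leaves r))) / 2 \<le>
        tree_dist n f (Query i l r) + \<tau> * log 2 (num_leaves (Query i l r))"
      using mean_tree_dist_subtrees[OF i, of f] log_le by argo
    then consider
        "tree_dist n f l + \<tau> * log 2 (num_leaves l) \<le>
          tree_dist n f (Query i l r) + \<tau> * log 2 (num_leaves (Query i l r))"
      | "tree_dist n f r + \<tau> * log 2 (num_leaves r) \<le>
          tree_dist n f (Query i l r) + \<tau> * log 2 (num_leaves (Query i l r))"
      by argo
    then show ?thesis
    proof cases
      case 1
      then show ?thesis
        using IHl[of f] is_pruning_left order_trans by meson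
    next
      case 2
      then show ?thesis
        using IHr[of f] is_pruning_right order_trans by meson
    qed
  qed
qed

theorem theorem4:
  fixes n s :: nat and f :: "(nat \<Rightarrow> int) \<Rightarrow> int" and T :: dtree and \<tau> :: real
  assumes "f \<in> cube n \<rightarrow> {-1, 1}"
    and "dtree_over n T"
    and "computes n T f"
    and "num_leaves T = s"
    and "\<tau> > 0"
  shows "\<exists>Tstar. is_pruning Tstar T \<and>
    measure_pmf.prob (pmf_of_set (cube n)) {x. f x \<noteq> dtree_eval Tstar x} \<le> \<tau> * log 2 (real s) \<and>
    (\<forall>(p, i)\<in>internal_nodes Tstar. influence n i (restriction f p) \<ge> \<tau>)"
proof -
  obtain T' where T': "is_pruning T' T" "no_repeats T'" "dtree_eval T' = dtree_eval T"
    by (rule ex_no_repeats_pruning)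
  obtain Tstar where Tstar: "is_pruning Tstar T'"
    "tree_dist n f Tstar \<le> tree_dist n f T' + \<tau> * log 2 (num_leaves T')"
    "\<forall>(p, i)\<in>internal_nodes Tstar. influence n i (restriction f p) \<ge> \<tau>"
    using ex_influential_pruning[OF \<open>\<tau> > 0\<close> dtree_over_pruning[OF T'(1) assms(2)] T'(2)] by blast
  \<comment> \<open>The repetition-free tree still computes \<open>f\<close>, so only the
    logarithmic term remains, and its leaf count is at most \<open>s\<close>.\<close>
  have "tree_dist n f T' = cube_prob n (\<lambda>x. False)"
    using assms(3) unfolding T'(3) computes_def by (intro cube_prob_cong) simp
  then have "tree_dist n f T' = 0"
    by simp
  moreover have "\<tau> * log 2 (num_leaves T') \<le> \<tau> * log 2 s"
    using num_leaves_pruning[OF T'(1)] num_leaves_pos[of T'] assms(4,5) by simp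
  ultimately have "tree_dist n f Tstar \<le> \<tau> * log 2 s"
    using Tstar(2) by linarith
  then show ?thesis
    using is_pruning_trans[OF Tstar(1) T'(1)] Tstar(3) by blast
qed

end
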